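(* Let $\alpha\in(0,1]$ and let $\boldsymbol{\mathcal{R}}\subseteq 2^{[m]}$ be a random collection of subsets of $[m]$. Then $\boldsymbol{\mathcal{R}}$ controls FDR at level $\alpha$ if and only if there exists a suite of $e$-values $\mathbf{E}=(\mathbf{e}_S)_{S\in\mathcal{M}}$ such that $\boldsymbol{\mathcal{R}}\subseteq \mathcal{R}_\alpha(\mathbf{E})$ (surely, i.e. for every outcome).
   Context: Setting: $M$ is a set of probability measures on a common measurable space; random variables, random sets and random collections of sets are measurable functions on that space. $m\ge 1$, $[m]=\{1,\dots,m\}$, and hypotheses $H_1,\dots,H_m\subseteq M$ are given. For $\mathrm{P}\in M$, $N_\mathrm{P}=\{i\in[m]: \mathrm{P}\in H_i\}$ and $\mathrm{E}_\mathrm{P}$ is expectation under $\mathrm{P}$. Write $a\vee b=\max(a,b)$ and $\mathcal{M}=2^{[m]}\setminus\{\emptyset\}$. For $S\subseteq[m]$ the partitioning hypothesis is $H_S=\{\mathrm{P}\in M: N_\mathrm{P}=S\}$ (possibly empty). An $e$-value for a hypothesis $H\subseteq M$ is a random variable $\mathbf{e}$ with values in $[0,\infty]$ such that $\mathrm{E}_\mathrm{P}(\mathbf{e})\le 1$ for all $\mathrm{P}\in H$. A suite of $e$-values is a family $\mathbf{E}=(\mathbf{e}_S)_{S\in\mathcal{M}}$ where $\mathbf{e}_S$ is an $e$-value for $H_S$ for every $S\in\mathcal{M}$. A random collection $\boldsymbol{\mathcal{R}}\subseteq 2^{[m]}$ controls FDR at level $\alpha$ if for every $\mathrm{P}\in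 M$, $\mathrm{E}_\mathrm{P}\big(\max_{R\in\boldsymbol{\mathcal{R}}}\frac{|R\cap N_\mathrm{P}|}{|R|\vee 1}\big)\le\alpha$ (the maximum over an empty collection is $0$). The $e$-partitioning procedure is the random collection $$\mathcal{R}_\alpha(\mathbf{E})=\Big\{R\in 2^{[m]}:\ \alpha\,\mathbf{e}_S\ge\frac{|R\cap S|}{|R|\vee 1}\ \text{for all } S\in\mathcal{M}\Big\}.$$ *)

theory Defs
  imports "HOL-Probability.Probability"
begin

definition null_indices :: "nat \<Rightarrow> (nat \<Rightarrow> 'a measure set) \<Rightarrow> 'a measure \<Rightarrow> nat set" where
  "null_indices m H P = {i \<in> {1..m}. P \<in> H i}"

definition nonempty_subsets :: "nat \<Rightarrow> nat set set" where
  "nonempty_subsets m = Pow {1..m} - {{}}"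

definition partitioning_hypothesis ::
    "nat \<Rightarrow> 'a measure set \<Rightarrow> (nat \<Rightarrow> 'a measure set) \<Rightarrow> nat set \<Rightarrow> 'a measure set" where
  "partitioning_hypothesis m M H S = {P \<in> M. null_indices m H P = S}"

text \<open>The measure \<open>\<Omega>\<close> below only serves as a measurable space: nothing depends on the
  values it assigns to events. The extended nonnegative reals \<open>ennreal\<close> are \<open>[0,\<infinity>]\<close>, and
  expectations of \<open>[0,\<infinity>]\<close>-valued random variables are nonnegative Lebesgue integrals.\<close>

definition e_value :: "'a measure \<Rightarrow> 'a measure set \<Rightarrow> ('a \<Rightarrow> ennreal) \<Rightarrow> bool" where
  "e_value \<Omega> K e \<longleftrightarrow> e \<in> borel_measurable \<Omega> \<and> (\<forall>P\<in>K. (\<integral>\<^sup>+ \<omega>. e \<omega> \<partial>P) \<le> 1)"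

text \<open>A suite is a function on all sets of naturals, of which only the values on the nonempty
  subsets of \<open>{1..m}\<close> matter.\<close>

definition e_value_suite ::
    "'a measure \<Rightarrow> nat \<Rightarrow> 'a measure set \<Rightarrow> (nat \<Rightarrow> 'a measure set)
      \<Rightarrow> (nat set \<Rightarrow> 'a \<Rightarrow> ennreal) \<Rightarrow> bool" where
  "e_value_suite \<Omega> m M H E \<longleftrightarrow>
     (\<forall>S\<in>nonempty_subsets m. e_value \<Omega> (partitioning_hypothesis m M H S) (E S))"

definition random_collection :: "'a measure \<Rightarrow> nat \<Rightarrow> ('a \<Rightarrow> nat set set) \<Rightarrow> bool" where
  "random_collection \<Omega> m \<R> \<longleftrightarrow> \<R> \<in> \<Omega> \<rightarrow>\<^sub>M count_space (Pow (Pow {1..m}))"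

definition false_discovery_proportion :: "nat set \<Rightarrow> nat set \<Rightarrow> real" where
  "false_discovery_proportion R N = real (card (R \<inter> N)) / real (max (card R) 1)"

definition max_false_discovery_proportion :: "nat set set \<Rightarrow> nat set \<Rightarrow> real" where
  "max_false_discovery_proportion C N =
     (if C = {} then 0 else Max ((\<lambda>R. false_discovery_proportion R N) ` C))"

text \<open>For a random collection the integrand is measurable with values in \<open>[0,1]\<close>, so the
  Bochner integral is the true expectation.\<close>

definition controls_FDR ::
    "nat \<Rightarrow> 'a measure set \<Rightarrow> (nat \<Rightarrow> 'a measure set) \<Rightarrow> real \<Rightarrow> ('a \<Rightarrow> nat set set) \<Rightarrow> bool" where
  "controls_FDR m M H \<alpha> \<R> \<longleftrightarrow>
     (\<forall>P\<in>M. (\<integral>\<omega>. max_false_discovery_proportion (\<R> \<omega>) (null_indices m H P) \<partial>P) \<le> \<alpha>)"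

definition e_partitioning ::
    "nat \<Rightarrow> real \<Rightarrow> (nat set \<Rightarrow> 'a \<Rightarrow> ennreal) \<Rightarrow> 'a \<Rightarrow> nat set set" where
  "e_partitioning m \<alpha> E \<omega> =
     {R \<in> Pow {1..m}. \<forall>S\<in>nonempty_subsets m.
        ennreal \<alpha> * E S \<omega> \<ge> ennreal (false_discovery_proportion R S)}"

end

theory Submission
  imports Defs
begin

text \<open>The worst false discovery proportion of the collection with respect to \<open>S\<close>, divided by
  \<open>\<alpha>\<close>, is the pointwise least \<open>e\<^sub>S\<close> for which the collection lies in the \<open>e\<close>-partitioning
  procedure. FDR control at \<open>P\<close> says exactly that this variable is an \<open>e\<close>-value when \<open>S\<close> is
  the set of true nulls of \<open>P\<close>.\<close>

lemma false_discovery_proportion_nonneg: "0 \<le> false_discovery_proportion R N"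
  by (simp add: false_discovery_proportion_def)

lemma false_discovery_proportion_le_1:
  assumes "finite R"
  shows "false_discovery_proportion R N \<le> 1"
proof -
  have "card (R \<inter> N) \<le> card R"
    using assms by (simp add: card_mono)
  then show ?thesis
    by (simp add: false_discovery_proportion_def field_simps)
qed

text \<open>Every numerator is the cardinality of an empty set. This settles the probability
  measures without true nulls, for which a suite provides no e-value.\<close>

lemma max_false_discovery_proportion_empty [simp]: "max_false_discovery_proportion C {} = 0"
proof -
  have "(\<lambda>R. false_discovery_proportion R {}) ` C = {0}" if "C \<noteq> {}"
    using that by (auto simp: false_discovery_proportion_def)
  then show ?thesis
    by (simp add: max_false_discovery_proportion_def)
qed

lemma false_discovery_proportion_le_max:
  assumes "finite C" "R \<in> C"
  shows "false_discovery_proportion R N \<le> max_false_discovery_proportion C N"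
  using assms by (auto simp: max_false_discovery_proportion_def)

text \<open>A finite nonempty collection attains its maximum, and the empty one has the default
  value 0. Bounds on single members thus carry over to the maximum as soon as they are checked for 0
  as well.\<close>

lemma max_false_discovery_proportion_cases:
  assumes "finite C"
  obtains "max_false_discovery_proportion C N = 0"
  | R where "R \<in> C" "max_false_discovery_proportion C N = false_discovery_proportion R N"
proof (cases "C = {}")
  case False
  then have "Max ((\<lambda>R. false_discovery_proportion R N) ` C)
      \<in> (\<lambda>R. false_discovery_proportion R N) ` C"
    using assms by (intro Max_in) auto
  with False that(2) show ?thesis
    by (auto simp: max_false_discovery_proportion_def)
qed (use that(1) in \<open>simp add: max_false_discovery_proportion_def\<close>)

lemma max_false_discovery_proportion_nonneg:
  assumes "finite C"
  shows "0 \<le> max_false_discovery_proportion C N"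
  using assms
  by (cases rule: max_false_discovery_proportion_cases[of C N])
    (simp_all add: false_discovery_proportion_nonneg)

lemma max_false_discovery_proportion_le_1:
  assumes "C \<subseteq> Pow {1..m}"
  shows "max_false_discovery_proportion C N \<le> 1"
proof -
  have fin: "finite C"
    using assms by (rule finite_subset) simp
  \<comment> \<open>An infinite set has \<open>card\<close> 0 but may meet \<open>N\<close> in
    several points, so the bound by 1 depends on finiteness.\<close>
  have "finite R" if "R \<in> C" for R
    using assms that by (auto intro: finite_subset)
  with fin show ?thesis
    by (cases rule: max_false_discovery_proportion_cases[of C N])
      (auto intro: false_discovery_proportion_le_1)
qed

lemma random_collection_subset:
  assumes "random_collection \<Omega> m \<R>" "\<omega> \<in> space \<Omega>"
  shows "\<R> \<omega> \<subseteq> Pow {1..m}"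
  using assms measurable_space[of \<R> \<Omega> "count_space (Pow (Pow {1..m}))" \<omega>]
  by (simp add: random_collection_def)

lemma random_collection_finite:
  assumes "random_collection \<Omega> m \<R>" "\<omega> \<in> space \<Omega>"
  shows "finite (\<R> \<omega>)"
  using random_collection_subset[OF assms] by (rule finite_subset) simp

text \<open>The collection takes values in a discrete space, on which every function is
  measurable.\<close>

lemma borel_measurable_max_false_discovery_proportion:
  assumes "random_collection \<Omega> m \<R>"
  shows "(\<lambda>\<omega>. max_false_discovery_proportion (\<R> \<omega>) N) \<in> borel_measurable \<Omega>"
  using assms unfolding random_collection_def
  by (rule measurable_compose) simp

text \<open>The quantifiers over \<open>R\<close> and \<open>S\<close> commute; for fixed
  \<open>S\<close>, bounding the proportions of all \<open>R\<close> in the collection amounts to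
  bounding their maximum. For an empty collection both sides hold trivially, thanks to the default
  value 0.\<close>

lemma subset_e_partitioning_iff:
  assumes "random_collection \<Omega> m \<R>" "\<omega> \<in> space \<Omega>"
  shows "\<R> \<omega> \<subseteq> e_partitioning m \<alpha> E \<omega> \<longleftrightarrow>
    (\<forall>S\<in>nonempty_subsets m.
      ennreal (max_false_discovery_proportion (\<R> \<omega>) S) \<le> ennreal \<alpha> * E S \<omega>)"
    (is "?lhs \<longleftrightarrow> ?rhs")
proof
  note fin = random_collection_finite[OF assms]
  show ?rhs if ?lhs
  proof
    fix S assume S: "S \<in> nonempty_subsets m"
    from fin show "ennreal (max_false_discovery_proportion (\<R> \<omega>) S) \<le> ennreal \<alpha> * E S \<omega>"
      by (cases rule: max_false_discovery_proportion_cases[of "\<R> \<omega>" S])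
        (use that S in \<open>auto simp: e_partitioning_def\<close>)
  qed
  show ?lhs if ?rhs
  proof
    fix R assume R: "R \<in> \<R> \<omega>"
    have "ennreal (false_discovery_proportion R S) \<le> ennreal \<alpha> * E S \<omega>"
      if "S \<in> nonempty_subsets m" for S
      using \<open>?rhs\<close> that ennreal_leI[OF false_discovery_proportion_le_max[OF fin R]]
      by (blast intro: order_trans)
    with R show "R \<in> e_partitioning m \<alpha> E \<omega>"
      using random_collection_subset[OF assms] by (auto simp: e_partitioning_def)
  qed
qed

text \<open>This links the Bochner integral in FDR control to the nonnegative integral in the
  definition of e-values. The integrand lies in [0,1], hence is integrable under a probability
  measure.\<close>

lemma nn_integral_max_false_discovery_proportion:
  assumes "random_collection \<Omega> m \<R>" "prob_space P" "sets P = sets \<Omega>"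
  shows "(\<integral>\<^sup>+\<omega>. ennreal (max_false_discovery_proportion (\<R> \<omega>) N) \<partial>P)
    = ennreal (\<integral>\<omega>. max_false_discovery_proportion (\<R> \<omega>) N \<partial>P)"
proof (rule nn_integral_eq_integral)
  interpret prob_space P by fact
  have space: "space P = space \<Omega>"
    using assms(3) by (rule sets_eq_imp_space_eq)
  have nonneg: "0 \<le> max_false_discovery_proportion (\<R> \<omega>) N" if "\<omega> \<in> space P" for \<omega>
    using that assms(1) space
    by (auto intro: max_false_discovery_proportion_nonneg random_collection_finite)
  show "AE \<omega> in P. 0 \<le> max_false_discovery_proportion (\<R> \<omega>) N"
    using nonneg by simp
  show "integrable P (\<lambda>\<omega>. max_false_discovery_proportion (\<R> \<omega>) N)"
  proof (rule integrable_const_bound[where B = 1])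
    show "AE \<omega> in P. norm (max_false_discovery_proportion (\<R> \<omega>) N) \<le> 1"
      using nonneg max_false_discovery_proportion_le_1[OF random_collection_subset[OF assms(1)]] space
      by (intro AE_I2) (simp add: abs_of_nonneg)
    show "(\<lambda>\<omega>. max_false_discovery_proportion (\<R> \<omega>) N) \<in> borel_measurable P"
      using borel_measurable_max_false_discovery_proportion[OF assms(1)]
      by (simp add: measurable_cong_sets[OF assms(3) refl])
  qed
qed

theorem theorem1:
  fixes \<Omega> :: "'a measure"
    and M :: "'a measure set"
    and m :: nat
    and H :: "nat \<Rightarrow> 'a measure set"
    and \<alpha> :: real
    and \<R> :: "'a \<Rightarrow> nat set set"
  assumes "\<And>P. P \<in> M \<Longrightarrow> prob_space P \<and> sets P = sets \<Omega>"
    and "1 \<le> m"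
    and "\<And>i. i \<in> {1..m} \<Longrightarrow> H i \<subseteq> M"
    and "0 < \<alpha>" and "\<alpha> \<le> 1"
    and "random_collection \<Omega> m \<R>"
  shows "controls_FDR m M H \<alpha> \<R> \<longleftrightarrow>
    (\<exists>E. e_value_suite \<Omega> m M H E \<and> (\<forall>\<omega>\<in>space \<Omega>. \<R> \<omega> \<subseteq> e_partitioning m \<alpha> E \<omega>))"
proof
  let ?F = "\<lambda>S \<omega>. max_false_discovery_proportion (\<R> \<omega>) S"
  note prob = conjunct1[OF assms(1)] and sets = conjunct2[OF assms(1)]
  note F_integral = nn_integral_max_false_discovery_proportion[OF assms(6) prob sets]
  \<comment> \<open>Since \<alpha> is positive, the two constants multiply to 1 as reals;
    associativity then gives the claim even for infinite \<open>x\<close>.\<close>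
  have scale: "ennreal \<alpha> * (ennreal (1 / \<alpha>) * x) = x" for x
    using assms(4) by (simp add: mult.assoc[symmetric] ennreal_mult[symmetric])
  {
    assume FDR: "controls_FDR m M H \<alpha> \<R>"
    define E where "E S \<omega> = ennreal (1 / \<alpha>) * ennreal (?F S \<omega>)" for S \<omega>
    have F_meas: "(\<lambda>\<omega>. ennreal (?F S \<omega>)) \<in> borel_measurable \<Omega>" for S
      using borel_measurable_max_false_discovery_proportion[OF assms(6)] by measurable
    have "e_value \<Omega> (partitioning_hypothesis m M H S) (E S)" for S
      unfolding e_value_def
    proof (intro conjI ballI)
      show "E S \<in> borel_measurable \<Omega>"
        unfolding E_def using F_meas by measurable
      fix P assume "P \<in> partitioning_hypothesis m M H S"
      then have P: "P \<in> M" and S: "null_indices m H P = S"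
        by (auto simp: partitioning_hypothesis_def)
      have "(\<integral>\<^sup>+\<omega>. E S \<omega> \<partial>P) = ennreal (1 / \<alpha>) * (\<integral>\<^sup>+\<omega>. ennreal (?F S \<omega>) \<partial>P)"
        unfolding E_def using F_meas
        by (intro nn_integral_cmult) (simp add: measurable_cong_sets[OF sets[OF P] refl])
      also have "\<dots> \<le> ennreal (1 / \<alpha>) * ennreal \<alpha>"
        using FDR P S F_integral[OF P P]
        by (auto simp: controls_FDR_def intro!: mult_left_mono ennreal_leI)
      also have "\<dots> = 1"
        using assms(4) by (simp add: ennreal_mult[symmetric])
      finally show "(\<integral>\<^sup>+\<omega>. E S \<omega> \<partial>P) \<le> 1" .
    qed
    then have "e_value_suite \<Omega> m M H E"
      by (simp add: e_value_suite_def)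
    \<comment> \<open>By \<open>scale\<close>, the required inequality holds with equality for this
      \<open>E\<close>.\<close>
    moreover have "\<R> \<omega> \<subseteq> e_partitioning m \<alpha> E \<omega>" if "\<omega> \<in> space \<Omega>" for \<omega>
      by (simp add: subset_e_partitioning_iff[OF assms(6) that] E_def scale)
    ultimately show "\<exists>E. e_value_suite \<Omega> m M H E \<and>
        (\<forall>\<omega>\<in>space \<Omega>. \<R> \<omega> \<subseteq> e_partitioning m \<alpha> E \<omega>)"
      by blast
  next
    assume "\<exists>E. e_value_suite \<Omega> m M H E \<and> (\<forall>\<omega>\<in>space \<Omega>. \<R> \<omega> \<subseteq> e_partitioning m \<alpha> E \<omega>)"
    then obtain E where suite: "e_value_suite \<Omega> m M H E"
      and sub: "\<And>\<omega>. \<omega> \<in> space \<Omega> \<Longrightarrow> \<R> \<omega> \<subseteq> e_partitioning m \<alpha> E \<omega>"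
      by blast
    show "controls_FDR m M H \<alpha> \<R>"
      unfolding controls_FDR_def
    proof
      fix P assume P: "P \<in> M"
      define S where "S = null_indices m H P"
      show "(\<integral>\<omega>. ?F (null_indices m H P) \<omega> \<partial>P) \<le> \<alpha>"
      proof (cases "S = {}")
        case True
        with assms(4) show ?thesis by (simp add: S_def)
      next
        case False
        then have S: "S \<in> nonempty_subsets m"
          by (auto simp: S_def nonempty_subsets_def null_indices_def)
        \<comment> \<open>\<open>P\<close> belongs to the partitioning hypothesis of its own set of
          true nulls, so \<open>E S\<close> has expectation at most 1 under
          \<open>P\<close>.\<close>
        with suite P have E_meas: "E S \<in> borel_measurable \<Omega>" and E_le: "(\<integral>\<^sup>+\<omega>. E S \<omega> \<partial>P) \<le> 1"
          by (auto simp: e_value_suite_def e_value_def partitioning_hypothesis_def S_def)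
        have "ennreal (\<integral>\<omega>. ?F S \<omega> \<partial>P) = (\<integral>\<^sup>+\<omega>. ennreal (?F S \<omega>) \<partial>P)"
          using F_integral[OF P P] by simp
        \<comment> \<open>The inclusion is known on the space of \<Omega>, which is also that of
          \<open>P\<close> because the sigma-algebras agree.\<close>
        also have "\<dots> \<le> (\<integral>\<^sup>+\<omega>. ennreal \<alpha> * E S \<omega> \<partial>P)"
          using sub S subset_e_partitioning_iff[OF assms(6)] sets_eq_imp_space_eq[OF sets[OF P]]
          by (intro nn_integral_mono) auto
        also have "\<dots> = ennreal \<alpha> * (\<integral>\<^sup>+\<omega>. E S \<omega> \<partial>P)"
          using E_meas
          by (intro nn_integral_cmult) (simp add: measurable_cong_sets[OF sets[OF P] refl])
        also have "\<dots> \<le> ennreal \<alpha>"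
          using mult_left_mono[OF E_le, of "ennreal \<alpha>"] by simp
        finally show ?thesis
          \<comment> \<open>Positivity of \<alpha> lets the inequality descend from
            \<open>ennreal\<close> to the reals.\<close>
          using assms(4) by (simp add: S_def)
      qed
    qed
  }
qed

end
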